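(* Let $T^d$ be the theory of dense pairs of real closed fields and let $(K,L)$ be a model of $T^d$. Then for each positive integer $n$ there is a partitioned formula $\phi(x;y)$ in the language of dense pairs of real closed fields, with $|y|=1$ (and $x$ a finite tuple of variables), whose VC-density in $(K,L)$ is at least $n$.
   Context: **Dense pairs of real closed fields.** The language is $\{+,-,\cdot,0,1,<,U\}$ with $U$ a unary relation symbol. A dense pair of real closed fields is a structure $(K,L)$ where $K$ is a real closed (ordered) field and $U$ is interpreted as a proper real closed subfield $L$ of $K$ (hence an elementary substructure) that is dense in $K$ (for all $a<b$ in $K$ there is $c\in L$ with $a<c<b$). The theory of such pairs is known to be complete. **Partitioned formulas and VC-density.** A partitioned formula $\phi(x;y)$ is a first-order formula (without parameters) whose free variables are split into object variables $x=(x_1,\dots,x_m)$ and parameter variables $y=(y_1,\dots,y_q)$; $|y|=q$. Let $\mathcal M$ be a structure with universe $M$. For $A\subseteq M^m$ put $A\cap\phi(\mathcal M;y)=\{A\cap\phi(\mathcal M;b):b\in M^{q}\}$, where $\phi(\mathcal M;b)=\{a\in M^m:\mathcal M\models\phi(a;b)\}$. The shatter function is $\pi_\phi(k)=\max\{|A\cap\phi(\mathcal M;y)|:A\subseteq M^m,\ |A|=k\}$. The VC-density of $\phi(x;y)$ in $\mathcal M$ is the infimum of the real numbers $r$ such that $\pi_\phi(k)=O(k^r)$ (and it is $\infty$ if there is no such $r$). *)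

theory Defs
  imports
    Complex_Main
    "HOL-Computational_Algebra.Polynomial"
    "HOL-Library.Extended_Real"
    "HOL-Library.Landau_Symbols"
begin

definition subfield_set :: "'a::field set \<Rightarrow> bool" where
  "subfield_set L \<longleftrightarrow>
     0 \<in> L \<and> 1 \<in> L \<and>
     (\<forall>a\<in>L. \<forall>b\<in>L. a + b \<in> L \<and> a - b \<in> L \<and> a * b \<in> L) \<and>
     (\<forall>a\<in>L. inverse a \<in> L)"

text \<open>A subfield carries the order induced from the ambient ordered field, so its
  nonnegative elements are those that are nonnegative in the ambient field.\<close>

definition real_closed :: "'a::linordered_field set \<Rightarrow> bool" where
  "real_closed L \<longleftrightarrow>
     subfield_set L \<and>
     (\<forall>a\<in>L. 0 \<le> a \<longrightarrow> (\<exists>b\<in>L. b ^ 2 = a)) \<and>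
     (\<forall>p. (\<forall>i. coeff p i \<in> L) \<longrightarrow> odd (degree p) \<longrightarrow> (\<exists>c\<in>L. poly p c = 0))"

text \<open>The big field \<open>K\<close> is the whole type \<open>'a\<close>; the pair is \<open>(UNIV, L)\<close>.\<close>

definition dense_pair :: "'a::linordered_field set \<Rightarrow> bool" where
  "dense_pair L \<longleftrightarrow>
     real_closed (UNIV :: 'a set) \<and> real_closed L \<and> L \<noteq> UNIV \<and>
     (\<forall>a b. a < b \<longrightarrow> (\<exists>c\<in>L. a < c \<and> c < b))"

datatype trm =
    Var nat
  | Zero
  | One
  | Add trm trm
  | Sub trm trm
  | Mul trm trm

datatype fm =
    Eq trm trm
  | Less trm trm
  | InU trm
  | Neg fm
  | Conj fm fm
  | Disj fm fm
  | Exists nat fm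
  | Forall nat fm

primrec vars :: "trm \<Rightarrow> nat set" where
  "vars (Var v) = {v}"
| "vars Zero = {}"
| "vars One = {}"
| "vars (Add s t) = vars s \<union> vars t"
| "vars (Sub s t) = vars s \<union> vars t"
| "vars (Mul s t) = vars s \<union> vars t"

primrec free_vars :: "fm \<Rightarrow> nat set" where
  "free_vars (Eq s t) = vars s \<union> vars t"
| "free_vars (Less s t) = vars s \<union> vars t"
| "free_vars (InU t) = vars t"
| "free_vars (Neg \<phi>) = free_vars \<phi>"
| "free_vars (Conj \<phi> \<psi>) = free_vars \<phi> \<union> free_vars \<psi>"
| "free_vars (Disj \<phi> \<psi>) = free_vars \<phi> \<union> free_vars \<psi>"
| "free_vars (Exists v \<phi>) = free_vars \<phi> - {v}"
| "free_vars (Forall v \<phi>) = free_vars \<phi> - {v}"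

primrec val :: "(nat \<Rightarrow> 'a::linordered_field) \<Rightarrow> trm \<Rightarrow> 'a" where
  "val e (Var v) = e v"
| "val e Zero = 0"
| "val e One = 1"
| "val e (Add s t) = val e s + val e t"
| "val e (Sub s t) = val e s - val e t"
| "val e (Mul s t) = val e s * val e t"

primrec sat :: "'a::linordered_field set \<Rightarrow> (nat \<Rightarrow> 'a) \<Rightarrow> fm \<Rightarrow> bool" where
  "sat L e (Eq s t) \<longleftrightarrow> val e s = val e t"
| "sat L e (Less s t) \<longleftrightarrow> val e s < val e t"
| "sat L e (InU t) \<longleftrightarrow> val e t \<in> L"
| "sat L e (Neg \<phi>) \<longleftrightarrow> \<not> sat L e \<phi>"
| "sat L e (Conj \<phi> \<psi>) \<longleftrightarrow> sat L e \<phi> \<and> sat L e \<psi>"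
| "sat L e (Disj \<phi> \<psi>) \<longleftrightarrow> sat L e \<phi> \<or> sat L e \<psi>"
| "sat L e (Exists v \<phi>) \<longleftrightarrow> (\<exists>c. sat L (e(v := c)) \<phi>)"
| "sat L e (Forall v \<phi>) \<longleftrightarrow> (\<forall>c. sat L (e(v := c)) \<phi>)"

text \<open>A partitioned formula is a formula together with the tuples \<open>xs\<close> of object
  variables and \<open>ys\<close> of parameter variables. Tuples of field elements are lists.\<close>

definition partitioned :: "fm \<Rightarrow> nat list \<Rightarrow> nat list \<Rightarrow> bool" where
  "partitioned \<phi> xs ys \<longleftrightarrow>
     xs \<noteq> [] \<and> distinct (xs @ ys) \<and> free_vars \<phi> = set xs \<union> set ys"

definition tuples :: "nat \<Rightarrow> 'a list set" where
  "tuples m = {a. length a = m}"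

definition defset ::
    "'a::linordered_field set \<Rightarrow> fm \<Rightarrow> nat list \<Rightarrow> nat list \<Rightarrow> 'a list \<Rightarrow> 'a list set" where
  "defset L \<phi> xs ys b =
     {a \<in> tuples (length xs). sat L (\<lambda>v. the (map_of (zip (xs @ ys) (a @ b)) v)) \<phi>}"

definition trace_family ::
    "'a::linordered_field set \<Rightarrow> fm \<Rightarrow> nat list \<Rightarrow> nat list \<Rightarrow> 'a list set \<Rightarrow> 'a list set set" where
  "trace_family L \<phi> xs ys A = {A \<inter> defset L \<phi> xs ys b | b. b \<in> tuples (length ys)}"

text \<open>The maximum is over a nonempty set of numbers bounded by \<open>2 ^ k\<close>: an ordered
  field is infinite, and \<open>xs\<close> is nonempty for a partitioned formula.\<close>

definition shatter ::
    "'a::linordered_field set \<Rightarrow> fm \<Rightarrow> nat list \<Rightarrow> nat list \<Rightarrow> nat \<Rightarrow> nat" where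
  "shatter L \<phi> xs ys k =
     Max {card (trace_family L \<phi> xs ys A) | A.
            A \<subseteq> tuples (length xs) \<and> finite A \<and> card A = k}"

text \<open>In \<^typ>\<open>ereal\<close> the infimum of the empty set is \<open>\<infinity>\<close>, as required.\<close>

definition vc_density ::
    "'a::linordered_field set \<Rightarrow> fm \<Rightarrow> nat list \<Rightarrow> nat list \<Rightarrow> ereal" where
  "vc_density L \<phi> xs ys =
     Inf {ereal r | r. (\<lambda>k. real (shatter L \<phi> xs ys k)) \<in> O(\<lambda>k. real k powr r)}"

end

theory Submission imports Defs begin

text \<open>If \<open>1, a, \<dots>, a ^ (n - 1)\<close> are linearly independent over \<open>L\<close>, a single \<open>y = \<Sum>i<n. l\<^sub>i * a ^ i\<close>
  codes \<open>n\<close> elements of \<open>L\<close>. With \<open>a\<close> as an object variable, the relation ``\<open>z\<close> is one of the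
  coefficients of \<open>y\<close>'' cuts out every \<open>n\<close>-element subset of \<open>{(a, 0), \<dots>, (a, k - 1)}\<close>, so the
  shatter function is at least \<open>k choose n\<close>. Such an \<open>a\<close> is found by raising the degree over \<open>L\<close> one
  step at a time; density of \<open>L\<close> replaces the factorisation theory of real closed fields.\<close>

section \<open>Elements of large degree over the small field\<close>

definition poly_over :: "'a::field set \<Rightarrow> 'a poly \<Rightarrow> bool" where
  "poly_over L p \<longleftrightarrow> (\<forall>i. coeff p i \<in> L)"

text \<open>Linear independence of \<open>1, a, ..., a ^ (d - 1)\<close> over \<open>L\<close>,
  phrased so that algebraic and transcendental \<open>a\<close> are treated alike.\<close>

definition degree_ge :: "'a::field set \<Rightarrow> nat \<Rightarrow> 'a \<Rightarrow> bool" where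
  "degree_ge L d a \<longleftrightarrow> (\<forall>q. poly_over L q \<longrightarrow> degree q < d \<longrightarrow> poly q a = 0 \<longrightarrow> q = 0)"

lemma degree_geD:
  "degree_ge L d a \<Longrightarrow> poly_over L q \<Longrightarrow> degree q < d \<Longrightarrow> poly q a = 0 \<Longrightarrow> q = 0"
  by (auto simp: degree_ge_def)

lemma degree_ge_mono: "degree_ge L d a \<Longrightarrow> e \<le> d \<Longrightarrow> degree_ge L e a"
  by (auto simp: degree_ge_def)

section \<open>Polynomials over a subfield and minimal polynomials\<close>

context
  fixes L :: "'a::field set"
  assumes L: "subfield_set L"
begin

lemma subfield_closed:
  shows "0 \<in> L" "1 \<in> L"
    and "a \<in> L \<Longrightarrow> b \<in> L \<Longrightarrow> a + b \<in> L"
    and "a \<in> L \<Longrightarrow> b \<in> L \<Longrightarrow> a - b \<in> L"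
    and "a \<in> L \<Longrightarrow> b \<in> L \<Longrightarrow> a * b \<in> L"
    and "a \<in> L \<Longrightarrow> b \<in> L \<Longrightarrow> a / b \<in> L"
    and "a \<in> L \<Longrightarrow> - a \<in> L"
proof -
  show "a \<in> L \<Longrightarrow> - a \<in> L"
    using L unfolding subfield_set_def by (metis diff_0)
qed (use L in \<open>auto simp: subfield_set_def divide_inverse\<close>)

lemma of_nat_in_subfield: "of_nat k \<in> L"
  by (induction k) (auto intro: subfield_closed)

lemma sum_in_subfield: "(\<And>i. i \<in> I \<Longrightarrow> f i \<in> L) \<Longrightarrow> sum f I \<in> L"
  by (induction I rule: infinite_finite_induct) (auto intro: subfield_closed)

lemma poly_over_pCons_iff: "poly_over L (pCons c p) \<longleftrightarrow> c \<in> L \<and> poly_over L p"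
  unfolding poly_over_def by (auto simp: coeff_pCons split: nat.splits)

lemma poly_over_0: "poly_over L 0"
  by (simp add: poly_over_def subfield_closed)

lemma poly_over_diff: "poly_over L p \<Longrightarrow> poly_over L q \<Longrightarrow> poly_over L (p - q)"
  by (simp add: poly_over_def subfield_closed)

lemma poly_over_add: "poly_over L p \<Longrightarrow> poly_over L q \<Longrightarrow> poly_over L (p + q)"
  by (simp add: poly_over_def subfield_closed)

lemma poly_over_smult: "c \<in> L \<Longrightarrow> poly_over L p \<Longrightarrow> poly_over L (smult c p)"
  by (simp add: poly_over_def subfield_closed)

lemma poly_over_mult: "poly_over L p \<Longrightarrow> poly_over L q \<Longrightarrow> poly_over L (p * q)"
  unfolding poly_over_def coeff_mult by (auto intro!: sum_in_subfield subfield_closed)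

lemma poly_over_pcompose: "poly_over L p \<Longrightarrow> poly_over L q \<Longrightarrow> poly_over L (p \<circ>\<^sub>p q)"
  by (induction p)
    (auto simp: pcompose_pCons poly_over_pCons_iff poly_over_0 intro!: poly_over_add poly_over_mult)

lemma poly_over_pderiv: "poly_over L p \<Longrightarrow> poly_over L (pderiv p)"
  unfolding poly_over_def coeff_pderiv by (auto intro: subfield_closed of_nat_in_subfield simp del: of_nat_Suc)

text \<open>Long division only ever divides by the leading coefficient of \<open>m\<close>, so it
  stays inside the subfield.\<close>

lemma poly_over_div_mod:
  assumes "poly_over L f" "poly_over L m"
  shows "poly_over L (f div m)" "poly_over L (f mod m)"
proof -
  have "poly_over L (f div m) \<and> poly_over L (f mod m)" if "m \<noteq> 0"
    using assms(1)
  proof (induction f)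
    case 0
    show ?case by (simp add: poly_over_0)
  next
    case (pCons c f)
    let ?r = "pCons c (f mod m)"
    let ?b = "coeff ?r (degree m) / coeff m (degree m)"
    have r: "poly_over L ?r" and q: "poly_over L (f div m)"
      using pCons by (auto simp: poly_over_pCons_iff)
    have b: "?b \<in> L"
      using r assms(2) unfolding poly_over_def by (intro subfield_closed) auto
    have "pCons c f div m = pCons ?b (f div m)" "pCons c f mod m = ?r - smult ?b m"
      using div_pCons_eq[of c f m] mod_pCons[OF that, of c f] that by auto
    with r q b assms(2) show ?case
      by (simp add: poly_over_pCons_iff poly_over_diff poly_over_smult)
  qed
  then show "poly_over L (f div m)" "poly_over L (f mod m)"
    using assms by (cases "m = 0"; simp add: poly_over_0)+
qed

lemma degree_ge_2:
  assumes "a \<notin> L"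
  shows "degree_ge L 2 a"
  unfolding degree_ge_def
proof (intro allI impI)
  fix q assume q: "poly_over L q" "degree q < 2" "poly q a = 0"
  obtain s t where st: "q = [:s, t:]"
    using q(2) by (metis degree1_coeffs degree_0_id less_2_cases One_nat_def pCons_0_0)
  show "q = 0"
  proof (cases "t = 0")
    case True
    with st q(3) show ?thesis by simp
  next
    case False
    with st q(3) have "a = - s / t"
      by (simp add: field_simps eq_neg_iff_add_eq_0)
    moreover have "- s / t \<in> L"
      using q(1) st by (intro subfield_closed) (auto simp: poly_over_pCons_iff)
    ultimately show ?thesis using assms by simp
  qed
qed

lemma minimal_poly_dvd:
  assumes "degree_ge L (degree p) a" "poly_over L p" "poly p a = 0" "p \<noteq> 0"
    and "poly_over L f" "poly f a = 0"
  shows "p dvd f"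
proof -
  have "poly (f mod p) a = 0"
    using assms by (metis poly_mod)
  moreover have "f mod p = 0 \<or> degree (f mod p) < degree p"
    using assms(4) by (rule degree_mod_less)
  ultimately have "f mod p = 0"
    using degree_geD[OF assms(1)] poly_over_div_mod(2)[OF assms(5,2)] by blast
  then show ?thesis by auto
qed

text \<open>Up to a scalar, \<open>p\<close> is the minimal polynomial of \<open>a\<close>, hence
  irreducible over \<open>L\<close>, hence also minimal for each of its other roots.\<close>

lemma degree_ge_conjugate:
  assumes p: "degree_ge L (degree p) a" "poly_over L p" "poly p a = 0" "p \<noteq> 0"
    and b: "poly p b = 0"
  shows "degree_ge L (degree p) b"
proof (rule ccontr)
  let ?Q = "\<lambda>m. poly_over L m \<and> m \<noteq> 0 \<and> poly m b = 0"
  assume "\<not> degree_ge L (degree p) b"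
  then obtain f where f: "?Q f" "degree f < degree p"
    by (auto simp: degree_ge_def)
  obtain m where m: "?Q m" and min: "\<And>q. ?Q q \<Longrightarrow> degree m \<le> degree q"
    using ex_has_least_nat[of ?Q f degree] f(1) by blast
  have less: "degree m < degree p"
    using min[OF f(1)] f(2) by simp
  have "degree_ge L (degree m) b"
    unfolding degree_ge_def using min by (meson leD)
  then have "m dvd p"
    using m p(2) b by (intro minimal_poly_dvd) auto
  then have eq: "p = p div m * m" by simp
  then have ne: "p div m \<noteq> 0" "m \<noteq> 0" using p(4) by auto
  have deg: "degree p = degree (p div m) + degree m"
    using degree_mult_eq[OF ne] eq by simp
  \<comment> \<open>One factor of \<open>p = p div m * m\<close> vanishes at \<open>a\<close>. The
    degree of \<open>m\<close> is too small, so it is the cofactor, which then has full degree and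
    leaves \<open>m\<close> a nonzero constant.\<close>
  have "poly m a \<noteq> 0"
    using degree_geD[OF p(1)] m less by blast
  then have "poly (p div m) a = 0"
    using eq p(3) by (metis mult_eq_0_iff poly_mult)
  then have "\<not> degree (p div m) < degree p"
    using degree_geD[OF p(1)] poly_over_div_mod(1)[OF p(2)] m ne by blast
  then have "degree m = 0" using deg by simp
  then show False using m by (metis degree_0_id pCons_0_0 poly_pCons mult_zero_right add_0_right poly_0)
qed

end

section \<open>Raising the degree by a square root\<close>

lemma poly_even_odd_split:
  fixes r :: "'a::comm_ring_1 poly"
  shows "\<exists>E D. (\<forall>i. coeff E i = coeff r (2 * i)) \<and> (\<forall>i. coeff D i = coeff r (2 * i + 1)) \<and>
    (\<forall>g. poly r g = poly E (g ^ 2) + g * poly D (g ^ 2))"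
proof (induction r)
  case 0
  show ?case by (intro exI[of _ 0]) simp
next
  case (pCons c r)
  then obtain E D where "\<And>i. coeff E i = coeff r (2 * i)" "\<And>i. coeff D i = coeff r (2 * i + 1)"
    "\<And>g. poly r g = poly E (g ^ 2) + g * poly D (g ^ 2)" by blast
  then show ?case
    \<comment> \<open>Prepending a coefficient shifts all indices by one, so the even and odd parts
      swap roles.\<close>
    by (intro exI[of _ "pCons c D"] exI[of _ E])
      (auto simp: coeff_pCons algebra_simps power2_eq_square split: nat.splits)
qed

text \<open>An automorphism of \<open>L(a)\<close> over \<open>L\<close> moving \<open>a\<close> to a conjugate \<open>b\<close> would preserve squares,
  hence the order, if \<open>L(a)\<close> were closed under square roots of positive elements; but the order and
  the dense set \<open>L\<close> pin \<open>a\<close> down. So some square root generates a larger extension.\<close>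

lemma ex_sqrt_degree_ge:
  fixes L :: "'a::linordered_field set"
  assumes L: "subfield_set L"
    and sqrt: "\<And>x::'a. 0 \<le> x \<Longrightarrow> \<exists>g. g ^ 2 = x"
    and p: "degree_ge L (degree p) a" "poly_over L p" "poly p a = 0" "2 \<le> degree p"
    and b: "poly p b = 0"
    and w: "poly_over L w" "degree w = 1" "0 < poly w a" "poly w b < 0"
  shows "\<exists>g. degree_ge L (Suc (degree p)) g"
proof (rule ccontr)
  assume none: "\<nexists>g. degree_ge L (Suc (degree p)) g"
  have p0: "p \<noteq> 0" using p(4) by auto
  obtain g where g: "g ^ 2 = poly w a"
    using sqrt w(3) less_imp_le by blast
  obtain r where r: "poly_over L r" "degree r \<le> degree p" "poly r g = 0" "r \<noteq> 0"
    using none unfolding degree_ge_def by (auto simp: less_Suc_eq_le)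
  obtain E D where E: "\<And>i. coeff E i = coeff r (2 * i)"
    and D: "\<And>i. coeff D i = coeff r (2 * i + 1)"
    and split: "\<And>g. poly r g = poly E (g ^ 2) + g * poly D (g ^ 2)"
    using poly_even_odd_split[of r] by blast
  have "degree E \<le> degree p - 1"
  proof (rule degree_le, intro allI impI)
    fix i assume "degree p - 1 < i"
    then have "degree r < 2 * i" using r(2) p(4) by linarith
    then show "coeff E i = 0" by (simp add: E coeff_eq_0)
  qed
  moreover have "degree D \<le> degree p - 1"
  proof (rule degree_le, intro allI impI)
    fix i assume "degree p - 1 < i"
    then have "degree r < 2 * i + 1" using r(2) p(4) by linarith
    then show "coeff D i = 0" by (simp add: D coeff_eq_0)
  qed
  \<comment> \<open>Since \<open>g ^ 2 = poly w a\<close>, composing with the linear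
    \<open>w\<close> turns the two parts of \<open>r\<close> into polynomials in \<open>a\<close> of
    degree still below that of \<open>p\<close>.\<close>
  moreover define u v where "u = D \<circ>\<^sub>p w" and "v = E \<circ>\<^sub>p w"
  ultimately have deg: "degree u < degree p" "degree v < degree p"
    using p(4) w(2) by (auto simp: degree_pcompose)
  have "poly_over L D" "poly_over L E"
    using r(1) by (simp_all add: poly_over_def D E)
  then have over: "poly_over L u" "poly_over L v"
    using w(1) by (simp_all add: u_def v_def poly_over_pcompose[OF L])
  have rel: "poly v a = - g * poly u a"
    using split[of g] r(3) g by (simp add: u_def v_def poly_pcompose eq_neg_iff_add_eq_0)
  have "u \<noteq> 0"
  proof
    assume "u = 0"
    then have "v = 0"
      using degree_geD[OF p(1) over(2) deg(2)] rel by simp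
    have "D = 0" "E = 0"
      using \<open>u = 0\<close> \<open>v = 0\<close> w(2) by (auto simp: u_def v_def pcompose_eq_0_iff)
    have "coeff r i = 0" for i
      using D[of "i div 2"] E[of "i div 2"] \<open>D = 0\<close> \<open>E = 0\<close>
      by (cases "even i") auto
    then show False using r(4) by (simp add: poly_eq_iff)
  qed
  \<comment> \<open>Squaring \<open>rel\<close> eliminates \<open>g\<close>. The resulting identity
    over \<open>L\<close> passes to the conjugate \<open>b\<close>, where
    \<open>poly w b < 0\<close> forces \<open>u\<close> to vanish.\<close>
  have "p dvd u * u * w - v * v"
  proof (rule minimal_poly_dvd[OF L p(1-3) p0])
    show "poly_over L (u * u * w - v * v)"
      using over w(1) L by (intro poly_over_diff poly_over_mult)
    show "poly (u * u * w - v * v) a = 0"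
      using rel g by (simp add: power2_eq_square algebra_simps)
  qed
  then have "poly (u * u * w - v * v) b = 0"
    using b by (metis dvd_trans poly_eq_0_iff_dvd)
  then have "poly u b ^ 2 * poly w b = poly v b ^ 2"
    using b by (auto simp: power2_eq_square algebra_simps)
  then have "poly u b = 0"
    using w(4) by (metis mult_pos_neg not_less zero_le_power2 zero_less_power2)
  moreover have "poly u b \<noteq> 0"
    using degree_geD[OF degree_ge_conjugate[OF L p(1-3) p0 b] over(1) deg(1)] \<open>u \<noteq> 0\<close> by blast
  ultimately show False by blast
qed

text \<open>Either \<open>a\<close> already works or it has degree exactly \<open>d\<close>. In the
  latter case it has a conjugate \<open>b\<close> in the big field, and density supplies a linear
  \<open>w\<close> over \<open>L\<close> of opposite signs at \<open>a\<close> and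
  \<open>b\<close>.\<close>

lemma dense_pair_degree_ge_step:
  fixes L :: "'a::linordered_field set"
  assumes dp: "dense_pair L" and a: "degree_ge L d a" and d: "2 \<le> d"
  shows "\<exists>g. degree_ge L (Suc d) g"
proof (cases "degree_ge L (Suc d) a")
  case False
  have L: "subfield_set L"
    and odd_root: "\<And>p. poly_over L p \<Longrightarrow> odd (degree p) \<Longrightarrow> \<exists>c\<in>L. poly p c = 0"
    and sqrt: "\<And>x::'a. 0 \<le> x \<Longrightarrow> \<exists>g. g ^ 2 = x"
    and odd_root_K: "\<And>p :: 'a poly. odd (degree p) \<Longrightarrow> \<exists>c. poly p c = 0"
    and dense: "\<And>a b. a < b \<Longrightarrow> \<exists>c\<in>L. a < c \<and> c < b"
    using dp by (auto simp: dense_pair_def real_closed_def poly_over_def)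
  obtain p where p: "poly_over L p" "degree p < Suc d" "poly p a = 0" "p \<noteq> 0"
    using False by (auto simp: degree_ge_def)
  then have deg: "degree p = d"
    using degree_geD[OF a p(1)] by fastforce
  note lin = poly_over_pCons_iff[OF L] poly_over_0[OF L] subfield_closed[OF L]
  \<comment> \<open>An odd degree would give \<open>p\<close> a root \<open>c\<close> in
    \<open>L\<close>. As a conjugate of \<open>a\<close>, it would have degree at least 2, yet
    \<open>[:- c, 1:]\<close> kills it.\<close>
  have "even d"
  proof (rule ccontr)
    assume "odd d"
    then obtain c where c: "c \<in> L" "poly p c = 0"
      using odd_root[OF p(1)] deg by auto
    let ?l = "[:- c, 1:]"
    have l: "poly_over L ?l" using c by (simp add: lin)
    have c_deg: "degree_ge L (degree p) c"
      using degree_ge_conjugate[OF L _ p(1) p(3,4) c(2)] a deg by simp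
    then have "?l = 0"
      using degree_geD[OF c_deg l] d deg by auto
    then show False by simp
  qed
  obtain q where q: "p = [:- a, 1:] * q"
    using p(3) by (metis dvdE poly_eq_0_iff_dvd)
  then have "q \<noteq> 0" using p(4) by auto
  then have "d = Suc (degree q)"
    using q deg degree_mult_eq[of "[:- a, 1:]" q] by simp
  then obtain b where b: "poly q b = 0"
    using odd_root_K[of q] \<open>even d\<close> by auto
  \<comment> \<open>A double root would be a root of the nonzero \<open>pderiv p\<close>, whose
    degree is too small.\<close>
  have "b \<noteq> a"
  proof
    assume "b = a"
    then have "poly (pderiv p) a = 0"
      using b unfolding q pderiv_mult by simp
    then have "pderiv p = 0"
      using degree_geD[OF a poly_over_pderiv[OF L p(1)]] d deg by (simp add: degree_pderiv)
    then show False
      using d deg by (simp add: pderiv_eq_0_iff)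
  qed
  have pb: "poly p b = 0" using q b by simp
  have "\<exists>w. poly_over L w \<and> degree w = 1 \<and> 0 < poly w a \<and> poly w b < 0"
  proof (cases "a < b")
    case True
    then obtain c where "c \<in> L" "a < c" "c < b" using dense by blast
    then show ?thesis by (intro exI[of _ "[:c, -1:]"]) (auto simp: lin)
  next
    case False
    then obtain c where "c \<in> L" "b < c" "c < a" using dense[of b a] \<open>b \<noteq> a\<close> by auto
    then show ?thesis by (intro exI[of _ "[:- c, 1:]"]) (auto simp: lin)
  qed
  then show ?thesis
    using ex_sqrt_degree_ge[OF L sqrt _ p(1,3) _ pb] a d deg by blast
qed blast

lemma dense_pair_ex_degree_ge:
  fixes L :: "'a::linordered_field set"
  assumes "dense_pair L"
  shows "\<exists>a. degree_ge L d a"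
proof -
  \<comment> \<open>The induction starts at 2, which any element outside \<open>L\<close>
    attains.\<close>
  have "\<exists>a. degree_ge L (k + 2) a" for k
  proof (induction k)
    case 0
    obtain a where "a \<notin> L" and "subfield_set L"
      using assms by (auto simp: dense_pair_def real_closed_def)
    then show ?case using degree_ge_2 by (metis add_0)
  next
    case (Suc k)
    then show ?case using dense_pair_degree_ge_step[OF assms] by auto
  qed
  from this[of d] show ?thesis using degree_ge_mono le_add1 by blast
qed

section \<open>The formula and its traces\<close>

text \<open>Terms have no powers, hence Horner's scheme; the constant coefficient comes first, as in
  \<open>Poly\<close>.\<close>

primrec horner :: "trm \<Rightarrow> nat list \<Rightarrow> trm" where
  "horner a [] = Zero"
| "horner a (v # vs) = Add (Var v) (Mul a (horner a vs))"

primrec all_in_U :: "nat list \<Rightarrow> fm" where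
  "all_in_U [] = Eq Zero Zero"
| "all_in_U (v # vs) = Conj (InU (Var v)) (all_in_U vs)"

primrec occurs_in :: "trm \<Rightarrow> nat list \<Rightarrow> fm" where
  "occurs_in t [] = Less Zero Zero"
| "occurs_in t (v # vs) = Disj (Eq t (Var v)) (occurs_in t vs)"

lemma val_horner: "val e (horner a vs) = poly (Poly (map e vs)) (val e a)"
  by (induction vs) auto

lemma sat_all_in_U: "sat L e (all_in_U vs) \<longleftrightarrow> e ` set vs \<subseteq> L"
  by (induction vs) auto

lemma sat_occurs_in: "sat L e (occurs_in t vs) \<longleftrightarrow> val e t \<in> e ` set vs"
  by (induction vs) auto

lemma sat_foldr_Exists:
  "sat L e (foldr Exists vs \<psi>) \<longleftrightarrow> (\<exists>f. (\<forall>v. v \<notin> set vs \<longrightarrow> f v = e v) \<and> sat L f \<psi>)"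
proof (induction vs arbitrary: e)
  case Nil
  show ?case by (auto simp flip: fun_eq_iff)
next
  case (Cons v vs)
  show ?case (is "?lhs \<longleftrightarrow> ?rhs")
  proof
    assume ?lhs
    then obtain c f where "\<forall>u. u \<notin> set vs \<longrightarrow> f u = (e(v := c)) u" "sat L f \<psi>"
      by (auto simp: Cons.IH)
    then show ?rhs by (intro exI[of _ f]) auto
  next
    assume ?rhs
    then obtain f where "\<forall>u. u \<notin> set (v # vs) \<longrightarrow> f u = e u" "sat L f \<psi>" by blast
    then show ?lhs by (auto simp: Cons.IH intro!: exI[of _ "f v"] exI[of _ f])
  qed
qed

lemma free_vars_formulas:
  "vars (horner a vs) = (if vs = [] then {} else vars a \<union> set vs)"
  "free_vars (all_in_U vs) = set vs"
  "free_vars (occurs_in t vs) = (if vs = [] then {} else vars t \<union> set vs)"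
  "free_vars (foldr Exists vs \<psi>) = free_vars \<psi> - set vs"
  by (induction vs) auto

text \<open>With object variables \<open>0\<close>, \<open>1\<close> for \<open>a\<close>, \<open>z\<close> and parameter variable \<open>2\<close>, the formula says that
  the parameter is \<open>\<Sum>i<n. l\<^sub>i * a ^ i\<close> for some \<open>l\<^sub>i\<close> in \<open>L\<close> one of which is \<open>z\<close>.\<close>

definition coeff_formula :: "nat \<Rightarrow> fm" where
  "coeff_formula n = (let vs = [3..<3 + n] in
     foldr Exists vs
       (Conj (all_in_U vs) (Conj (Eq (Var 2) (horner (Var 0) vs)) (occurs_in (Var 1) vs))))"

text \<open>For \<open>n = 0\<close> the variables 0 and 1 would not occur, while
  \<open>partitioned\<close> asks for exactly the listed free variables.\<close>

lemma partitioned_coeff_formula: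
  "n \<ge> 1 \<Longrightarrow> partitioned (coeff_formula n) [0, 1] [2]"
  by (auto simp: partitioned_def coeff_formula_def Let_def free_vars_formulas)

lemma sat_coeff_formula:
  "sat L e (coeff_formula n) \<longleftrightarrow>
     (\<exists>cs. length cs = n \<and> set cs \<subseteq> L \<and> e 2 = poly (Poly cs) (e 0) \<and> e 1 \<in> set cs)"
    (is "?lhs \<longleftrightarrow> ?rhs")
proof
  assume ?lhs
  then obtain f where "\<forall>v. v \<notin> {3..<3 + n} \<longrightarrow> f v = e v" "f ` {3..<3 + n} \<subseteq> L"
    "f 2 = poly (Poly (map f [3..<3 + n])) (f 0)" "f 1 \<in> f ` {3..<3 + n}"
    by (auto simp: coeff_formula_def Let_def sat_foldr_Exists sat_all_in_U val_horner sat_occurs_in)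
  then show ?rhs by (intro exI[of _ "map f [3..<3 + n]"]) auto
next
  assume ?rhs
  then obtain cs where cs: "length cs = n" "set cs \<subseteq> L" "e 2 = poly (Poly cs) (e 0)" "e 1 \<in> set cs"
    by blast
  define f where "f v = (if v \<in> {3..<3 + n} then cs ! (v - 3) else e v)" for v
  have map: "map f [3..<3 + n] = cs"
    by (rule nth_equalityI) (auto simp: f_def cs(1))
  then have "f ` {3..<3 + n} = set cs"
    by (metis image_set set_upt)
  moreover have "\<forall>v. v \<notin> set [3..<3 + n] \<longrightarrow> f v = e v" "f 0 = e 0" "f 1 = e 1" "f 2 = e 2"
    by (auto simp: f_def)
  ultimately show ?lhs
    using map cs unfolding coeff_formula_def Let_def sat_foldr_Exists
    by (intro exI[of _ f]) (simp add: sat_all_in_U val_horner sat_occurs_in)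
qed

lemma Poly_eq_imp_eq:
  assumes L: "subfield_set L" and a: "degree_ge L n a"
    and cs: "length cs = n" "set cs \<subseteq> L" and ds: "length ds = n" "set ds \<subseteq> L"
    and eq: "poly (Poly cs) a = poly (Poly ds) a"
  shows "cs = ds"
proof -
  have over: "poly_over L (Poly xs)" if "set xs \<subseteq> L" for xs
    using that by (induction xs) (auto simp: poly_over_pCons_iff[OF L] poly_over_0[OF L])
  have "Poly cs = Poly ds"
  proof (rule ccontr)
    assume ne: "Poly cs \<noteq> Poly ds"
    have "coeff (Poly cs - Poly ds) i = 0" if "n \<le> i" for i
      using that cs ds by (simp add: nth_default_beyond)
    then have "degree (Poly cs - Poly ds) < n"
      using ne by (metis leading_coeff_0_iff not_less right_minus_eq)
    then show False
      using degree_geD[OF a poly_over_diff[OF L over[OF cs(2)] over[OF ds(2)]]] eq ne by simp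
  qed
  \<comment> \<open>\<open>Poly\<close> forgets trailing zeros; the common length \<open>n\<close>
    restores them.\<close>
  then have "nth_default 0 cs i = nth_default 0 ds i" for i
    by (metis coeff_Poly_eq)
  then show ?thesis
    using cs(1) ds(1) by (intro nth_equalityI) (metis nth_default_nth)+
qed

section \<open>Counting traces and bounding the VC-density\<close>

lemma finite_trace_card_set:
  "finite {card (trace_family L \<phi> xs ys A) | A. A \<subseteq> tuples (length xs) \<and> finite A \<and> card A = k}"
proof (rule finite_subset)
  show "{card (trace_family L \<phi> xs ys A) | A. A \<subseteq> tuples (length xs) \<and> finite A \<and> card A = k} \<subseteq> {..2 ^ k}"
  proof safe
    fix A :: "'a list set" assume A: "finite A" "k = card A"
    have "trace_family L \<phi> xs ys A \<subseteq> Pow A" by (auto simp: trace_family_def)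
    then show "card (trace_family L \<phi> xs ys A) \<le> 2 ^ card A"
      using card_mono[of "Pow A"] A by (simp add: card_Pow)
  qed
qed simp

lemma trace_family_card_le_shatter:
  assumes "A \<subseteq> tuples (length xs)" "finite A"
  shows "card (trace_family L \<phi> xs ys A) \<le> shatter L \<phi> xs ys (card A)"
  unfolding shatter_def by (rule Max_ge[OF finite_trace_card_set]) (use assms in blast)

lemma binomial_le_shatter:
  fixes L :: "'a::linordered_field set"
  assumes L: "subfield_set L" and a: "degree_ge L n a"
  shows "k choose n \<le> shatter L (coeff_formula n) [0, 1] [2] k"
proof -
  define pt :: "nat \<Rightarrow> 'a list" where "pt j = [a, of_nat j]" for j
  define A where "A = pt ` {..<k}"
  define F where "F = {S. S \<subseteq> {..<k} \<and> card S = n}"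
  have inj: "inj pt" by (auto simp: pt_def inj_def)
  have card_A: "card A = k"
    by (simp add: A_def card_image inj_on_subset[OF inj])
  have A: "A \<subseteq> tuples (length [0, 1 :: nat])" "finite A"
    by (auto simp: A_def tuples_def pt_def)
  have mem: "pt ` S \<in> trace_family L (coeff_formula n) [0, 1] [2] A" if "S \<in> F" for S
  proof -
    have S: "S \<subseteq> {..<k}" "card S = n" using that by (auto simp: F_def)
    then have fin: "finite S" by (auto intro: finite_subset)
    \<comment> \<open>The order of the coefficients is immaterial: the formula only asks whether
      \<open>z\<close> is among them.\<close>
    define cs :: "'a list" where "cs = map of_nat (sorted_list_of_set S)"
    have cs: "length cs = n" "set cs = of_nat ` S" "set cs \<subseteq> L"
      using S fin of_nat_in_subfield[OF L] by (auto simp: cs_def)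
    define y where "y = poly (Poly cs) a"
    \<comment> \<open>Uniqueness of the coding leaves \<open>cs\<close> as the only witness for
      \<open>y\<close>.\<close>
    have "(\<exists>ds. length ds = n \<and> set ds \<subseteq> L \<and> y = poly (Poly ds) a \<and> z \<in> set ds) \<longleftrightarrow> z \<in> set cs" for z
      using Poly_eq_imp_eq[OF L a cs(1,3)] cs unfolding y_def by metis
    then have "pt j \<in> defset L (coeff_formula n) [0, 1] [2] [y] \<longleftrightarrow> j \<in> S" for j
      using cs(2) by (auto simp: defset_def sat_coeff_formula pt_def tuples_def)
    then have "pt ` S = A \<inter> defset L (coeff_formula n) [0, 1] [2] [y]"
      using S(1) by (auto simp: A_def)
    then show ?thesis
      unfolding trace_family_def by (auto simp: tuples_def intro!: exI[of _ "[y]"])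
  qed
  have "finite (trace_family L (coeff_formula n) [0, 1] [2] A)"
    by (rule finite_subset[of _ "Pow A"]) (use A in \<open>auto simp: trace_family_def\<close>)
  then have "card ((`) pt ` F) \<le> card (trace_family L (coeff_formula n) [0, 1] [2] A)"
    using mem by (intro card_mono) auto
  moreover have "card ((`) pt ` F) = k choose n"
    using n_subsets[of "{..<k}" n] inj
    by (subst card_image) (auto simp: F_def inj_on_def inj_image_eq_iff)
  ultimately show ?thesis
    using trace_family_card_le_shatter[OF A] card_A by (metis order_trans)
qed

text \<open>For large \<open>k\<close>, \<open>k ^ n\<close> is at most \<open>n ^ n\<close> times
  \<open>k choose n\<close>, so any admissible exponent \<open>r\<close> satisfies
  \<open>n \<le> r\<close>.\<close>

lemma le_vc_density_if_binomial_le: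
  assumes "\<And>k. k choose n \<le> shatter L \<phi> xs ys k"
  shows "ereal (real n) \<le> vc_density L \<phi> xs ys"
  unfolding vc_density_def
proof (rule Inf_greatest, safe)
  fix r
  assume r: "(\<lambda>k. real (shatter L \<phi> xs ys k)) \<in> O(\<lambda>k. real k powr r)"
  have "(\<lambda>k. real k powr real n) \<in> O(\<lambda>k. real (k choose n))"
  proof (rule bigoI[where c = "real n ^ n"])
    show "\<forall>\<^sub>F k in sequentially. norm (real k powr real n) \<le> real n ^ n * norm (real (k choose n))"
      \<comment> \<open>The binomial bound wants \<open>n \<le> k\<close>; positivity of
        \<open>k\<close> makes \<open>powr\<close> agree with the natural power.\<close>
      using eventually_ge_at_top[of "max n 1"]
    proof eventually_elim
      case (elim k)
      then have "(real k / real n) ^ n \<le> real (k choose n)"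
        using binomial_ge_n_over_k_pow_k[of n k, where 'a = real] by simp
      then show ?case
        using elim by (cases "n = 0") (auto simp: powr_realpow field_simps)
    qed
  qed
  also have "(\<lambda>k. real (k choose n)) \<in> O(\<lambda>k. real (shatter L \<phi> xs ys k))"
    using assms by (intro bigoI[where c = 1]) auto
  also note r
  finally have "real n \<le> r"
    using powr_bigo_iff[OF filterlim_real_sequentially] by simp
  then show "ereal (real n) \<le> ereal r" by simp
qed

theorem mainTheorem5:
  fixes L :: "'a::linordered_field set" and n :: nat
  assumes "dense_pair L" and "n \<ge> 1"
  shows "\<exists>\<phi> xs ys. partitioned \<phi> xs ys \<and> length ys = 1 \<and>
           ereal (real n) \<le> vc_density L \<phi> xs ys"
proof -
  have "subfield_set L"
    using assms(1) by (auto simp: dense_pair_def real_closed_def)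
  moreover obtain a where "degree_ge L n a"
    using dense_pair_ex_degree_ge[OF assms(1)] by blast
  ultimately have "ereal (real n) \<le> vc_density L (coeff_formula n) [0, 1] [2]"
    by (intro le_vc_density_if_binomial_le binomial_le_shatter)
  then show ?thesis
    using partitioned_coeff_formula[OF assms(2)] by (intro exI[of _ "coeff_formula n"] exI conjI) auto
qed

end
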